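(* Let $\mathfrak{X}=(V,\{A_i\}_{i=0}^d)$ be a symmetric association scheme, and let $G$ be a graph with adjacency matrix $A_i$, where $1\leq i\leq d$. If $G$ is connected, then for any adjacent vertices $u$ and $v$ in $G$, $H(G;(v,u))=|V|-1$.
   Context: Here $V$ is finite and $A_0=I$. $H(G;(v,u))$ is the average hitting time from $u$ to $v$: the expected number of steps needed to reach $v$ for the first time in the simple random walk on $G$ started at $u$ (at each step the walk moves to a uniformly random neighbour of the current vertex). *)

theory Defs
  imports "HOL-Probability.Probability" "Graph_Theory.Graph_Theory"
begin

text \<open>
  The finite vertex set \<open>V\<close> is the universe of a finite type \<open>'v\<close>, and matrices indexed by
  \<open>V\<close> are elements of \<open>real ^ 'v ^ 'v\<close>. The sum condition says that the relations encoded by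
  the 0/1 matrices \<open>A 0, \<dots>, A d\<close> partition \<open>V \<times> V\<close>; the numbers \<open>p k\<close> in the last
  condition are the intersection numbers of the scheme. Values \<open>A i\<close> for \<open>i > d\<close> are
  irrelevant.
\<close>

locale symmetric_association_scheme =
  fixes A :: "nat \<Rightarrow> real ^ 'v ^ 'v::finite" and d :: nat
  assumes zero_one: "i \<le> d \<Longrightarrow> A i $ x $ y \<in> {0, 1}"
    and nonzero: "i \<le> d \<Longrightarrow> A i \<noteq> 0"
    and A_0: "A 0 = mat 1"
    and sum_A: "(\<Sum>i\<le>d. A i) = (\<chi> x y. 1)"
    and symmetric_A: "i \<le> d \<Longrightarrow> transpose (A i) = A i"
    and mult_A: "i \<le> d \<Longrightarrow> j \<le> d \<Longrightarrow>
      \<exists>p :: nat \<Rightarrow> nat. A i ** A j = (\<Sum>k\<le>d. real (p k) *\<^sub>R A k)"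

definition adjacency_matrix :: "'v::finite pair_pre_digraph \<Rightarrow> real ^ 'v ^ 'v" where
  "adjacency_matrix G = (\<chi> x y. if (x, y) \<in> parcs G then 1 else 0)"

text \<open>
  The distribution of the \<open>n\<close>-th position of the simple random walk on \<open>G\<close> started at \<open>u\<close>,
  given the history \<open>\<omega> 0, \<dots>, \<omega> (n - 1)\<close>. It is unspecified if the current vertex
  has no neighbour (or infinitely many).
\<close>

definition walk_step :: "'v pair_pre_digraph \<Rightarrow> 'v \<Rightarrow> nat \<Rightarrow> (nat \<Rightarrow> 'v) \<Rightarrow> 'v pmf" where
  "walk_step G u n \<omega> =
     (case n of 0 \<Rightarrow> return_pmf u | Suc m \<Rightarrow> pmf_of_set {y. (\<omega> m, y) \<in> parcs G})"

lemma Ionescu_Tulcea_walk: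
  "Ionescu_Tulcea (\<lambda>n \<omega>. measure_pmf (walk_step G u n \<omega>)) (\<lambda>_. count_space UNIV)"
proof
  fix n
  show "(\<lambda>\<omega>. measure_pmf (walk_step G u n \<omega>))
    \<in> Pi\<^sub>M {0..<n} (\<lambda>_. count_space UNIV) \<rightarrow>\<^sub>M subprob_algebra (count_space UNIV)"
  proof (cases n)
    case 0
    then show ?thesis
      by (auto simp: walk_step_def space_subprob_algebra
          intro!: measurable_const measure_pmf.subprob_space_axioms)
  next
    case (Suc m)
    have "(\<lambda>x. measure_pmf (pmf_of_set {y. (x, y) \<in> parcs G}))
      \<in> count_space UNIV \<rightarrow>\<^sub>M subprob_algebra (count_space UNIV)"
      by (auto simp: space_subprob_algebra intro!: measure_pmf.subprob_space_axioms)
    moreover have "(\<lambda>\<omega>. \<omega> m) \<in> Pi\<^sub>M {0..<n} (\<lambda>_. count_space UNIV) \<rightarrow>\<^sub>M count_space UNIV"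
      using Suc by (intro measurable_component_singleton) auto
    ultimately show ?thesis
      using Suc by (auto simp: walk_step_def intro: measurable_compose)
  qed
qed

text \<open>The law of the trajectory \<open>\<omega> 0, \<omega> 1, \<dots>\<close> of the walk, by the Ionescu-Tulcea theorem.\<close>

definition simple_random_walk :: "'v pair_pre_digraph \<Rightarrow> 'v \<Rightarrow> (nat \<Rightarrow> 'v) measure" where
  "simple_random_walk G u =
     projective_family.lim UNIV
       (Ionescu_Tulcea.CI (\<lambda>n \<omega>. measure_pmf (walk_step G u n \<omega>)) (\<lambda>_. count_space UNIV))
       (\<lambda>_. count_space UNIV)"

lemma sets_simple_random_walk:
  "sets (simple_random_walk G u) = sets (Pi\<^sub>M UNIV (\<lambda>_. count_space UNIV))"
proof -
  interpret Ionescu_Tulcea "\<lambda>n \<omega>. measure_pmf (walk_step G u n \<omega>)" "\<lambda>_. count_space UNIV"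
    by (rule Ionescu_Tulcea_walk)
  show ?thesis
    unfolding simple_random_walk_def by (rule PF.sets_lim)
qed

lemma emeasure_simple_random_walk_cylinder:
  "emeasure (simple_random_walk G u) {\<omega>. \<forall>i<n. \<omega> i = x i} =
     (\<Prod>i<n. ennreal (pmf (walk_step G u i x) (x i)))"
proof -
  let ?M = "\<lambda>_::nat. count_space UNIV :: 'a measure"
  interpret Ionescu_Tulcea "\<lambda>n \<omega>. measure_pmf (walk_step G u n \<omega>)" ?M
    by (rule Ionescu_Tulcea_walk)
  let ?cyl = "\<lambda>n. Pi\<^sub>E {0..<n} (\<lambda>i. {x i})"
  have cyl [measurable]: "?cyl n \<in> sets (Pi\<^sub>M {0..<n} ?M)" for n
    by (intro sets_PiM_I_finite) auto
  have "emeasure (C 0 n (\<lambda>_. undefined)) (?cyl n) =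
    (\<Prod>i<n. ennreal (pmf (walk_step G u i x) (x i)))"
  proof (induction n)
    case 0
    then show ?case by (simp add: space_PiM PiM_empty)
  next
    case (Suc n)
    have *: "emeasure (eP n \<omega>) (?cyl (Suc n)) =
        ennreal (pmf (walk_step G u n x) (x n)) * indicator (?cyl n) \<omega>"
      if \<omega>: "\<omega> \<in> space (Pi\<^sub>M {0..<n} ?M)" for \<omega>
    proof -
      have "emeasure (eP n \<omega>) (?cyl (Suc n)) =
          emeasure (measure_pmf (walk_step G u n \<omega>)) (fun_upd \<omega> n -` ?cyl (Suc n))"
        using emeasure_eP[OF \<omega> cyl] by simp
      also have "fun_upd \<omega> n -` ?cyl (Suc n) = (if \<omega> \<in> ?cyl n then {x n} else {})"
        using \<omega> by (auto simp: space_PiM PiE_iff extensional_def fun_upd_def less_Suc_eq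
            split: if_splits)
      also have "emeasure (measure_pmf (walk_step G u n \<omega>)) \<dots> =
          ennreal (pmf (walk_step G u n x) (x n)) * indicator (?cyl n) \<omega>"
      proof (cases "\<omega> \<in> ?cyl n")
        case True
        then have "walk_step G u n \<omega> = walk_step G u n x"
          by (auto simp: walk_step_def PiE_iff split: nat.split)
        then show ?thesis
          using True by (simp add: emeasure_pmf_single)
      qed simp
      finally show ?thesis .
    qed
    have "emeasure (C 0 (Suc n) (\<lambda>_. undefined)) (?cyl (Suc n)) =
        (\<integral>\<^sup>+\<omega>. emeasure (eP n \<omega>) (?cyl (Suc n)) \<partial>C 0 n (\<lambda>_. undefined))"
      using measurable_eP[of n] cyl[of "Suc n"]
      by (simp add: emeasure_bind[where N = "Pi\<^sub>M {0..<Suc n} ?M"] space_C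
          measurable_cong_sets[OF sets_C refl] space_PiM_empty_iff)
    also have "\<dots> = (\<integral>\<^sup>+\<omega>. ennreal (pmf (walk_step G u n x) (x n)) * indicator (?cyl n) \<omega>
        \<partial>C 0 n (\<lambda>_. undefined))"
      using * by (intro nn_integral_cong) (simp add: space_C)
    also have "\<dots> = ennreal (pmf (walk_step G u n x) (x n)) *
        emeasure (C 0 n (\<lambda>_. undefined)) (?cyl n)"
      using cyl[of n] by (intro nn_integral_cmult_indicator) (simp add: sets_C)
    finally show ?case
      using Suc by (simp add: mult.commute)
  qed
  moreover have "emeasure (simple_random_walk G u) (PF.emb UNIV {0..<n} (?cyl n)) =
      emeasure (C 0 n (\<lambda>_. undefined)) (?cyl n)"
    unfolding simple_random_walk_def
    using cyl[of n]
    by (subst lim) (auto simp: emeasure_CI[of _ n] prod_emb_id PiE_iff)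
  moreover have "PF.emb UNIV {0..<n} (?cyl n) = {\<omega>. \<forall>i<n. \<omega> i = x i}"
    by (auto simp: prod_emb_def space_PiM PiE_iff)
  ultimately show ?thesis by simp
qed

lemma prob_space_simple_random_walk: "prob_space (simple_random_walk G u)"
proof (rule prob_spaceI)
  have "space (simple_random_walk G u) = UNIV"
    using sets_eq_imp_space_eq[OF sets_simple_random_walk[of G u]] by (simp add: space_PiM)
  then show "emeasure (simple_random_walk G u) (space (simple_random_walk G u)) = 1"
    using emeasure_simple_random_walk_cylinder[of G u 0] by simp
qed

text \<open>The first \<open>n\<close> with \<open>\<omega> n = v\<close>, and \<open>\<infinity>\<close> if there is none.\<close>

definition first_hit :: "'v \<Rightarrow> (nat \<Rightarrow> 'v) \<Rightarrow> ennreal" where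
  "first_hit v \<omega> = (INF n\<in>{n. \<omega> n = v}. of_nat n)"

text \<open>\<open>H(G; (v, u))\<close>: the target \<open>v\<close> comes first, the starting vertex \<open>u\<close> second.\<close>

definition avg_hitting_time :: "'v pair_pre_digraph \<Rightarrow> 'v \<times> 'v \<Rightarrow> ennreal" where
  "avg_hitting_time G = (\<lambda>(v, u). \<integral>\<^sup>+\<omega>. first_hit v \<omega> \<partial>simple_random_walk G u)"

end

theory Submission
  imports Defs
begin

text \<open>
  Let \<open>T\<close> be the hitting time of \<open>v\<close> and \<open>f\<^sub>n x\<close> the probability that \<open>T > n\<close> for the walk started
  at \<open>x\<close>. The average hitting time from \<open>u\<close> is the sum of the tails \<open>f\<^sub>n u\<close>, and this sum is
  evaluated by combining two facts.

  The first is a form of Kac's return time formula (\<open>sums_neighbour_average_survival\<close>). Away from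
  \<open>v\<close>, \<open>f\<^sub>n\<^sub>+\<^sub>1\<close> is the neighbour average of \<open>f\<^sub>n\<close>; at \<open>v\<close> it is \<open>0\<close>. On a regular graph averaging over
  neighbours preserves the total \<open>S\<^sub>n\<close> of \<open>f\<^sub>n\<close> over all vertices, so the total drops from \<open>S\<^sub>n\<close> to
  \<open>S\<^sub>n\<^sub>+\<^sub>1\<close> by exactly the neighbour average of \<open>f\<^sub>n\<close> at \<open>v\<close>. These averages therefore sum to
  \<open>S\<^sub>0 - lim S\<^sub>n\<close>. Here \<open>S\<^sub>0\<close> is the number of vertices other than \<open>v\<close>, and connectedness gives
  \<open>S\<^sub>n \<longlonglongrightarrow> 0\<close>.

  The second is that \<open>f\<^sub>n x\<close> depends only on the class of the scheme to which \<open>(x, v)\<close> belongs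
  (\<open>survival_combination\<close>): as a matrix in \<open>x\<close> and \<open>v\<close>, it arises from the all-ones matrix by
  multiplying with \<open>A i\<close>, scaling and erasing the diagonal, and the span of the \<open>A j\<close> is closed
  under these operations. Hence all neighbours of \<open>v\<close> share the value \<open>f\<^sub>n u\<close>, which is then the
  neighbour average of \<open>f\<^sub>n\<close> at \<open>v\<close>.
\<close>

section \<open>The Markov property\<close>

lemma measurable_simple_random_walk_component [measurable]:
  "(\<lambda>\<omega>. \<omega> n) \<in> simple_random_walk G u \<rightarrow>\<^sub>M count_space UNIV"
  by (simp add: measurable_cong_sets[OF sets_simple_random_walk refl])

lemma space_simple_random_walk [simp]: "space (simple_random_walk G u) = UNIV"
  using sets_eq_imp_space_eq[OF sets_simple_random_walk[of G u]] by (simp add: space_PiM)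

lemma measure_simple_random_walk_cylinder:
  "measure (simple_random_walk G u) {\<omega>. \<forall>i<n. \<omega> i = x i} = (\<Prod>i<n. pmf (walk_step G u i x) (x i))"
  by (simp add: measure_def emeasure_simple_random_walk_cylinder prod_ennreal prod_nonneg)

text \<open>
  Since there are finitely many vertices, an event determined by the first \<open>n + 1\<close> positions is a
  finite disjoint union of cylinders, and on a cylinder the product formula splits off the last step.
\<close>

lemma measure_simple_random_walk_markov:
  fixes G :: "'v::finite pair_pre_digraph"
  assumes Q: "\<And>\<omega> \<omega>'. (\<And>i. i \<le> n \<Longrightarrow> \<omega> i = \<omega>' i) \<Longrightarrow> Q \<omega> \<Longrightarrow> Q \<omega>'"
  shows "measure (simple_random_walk G u) {\<omega>. Q \<omega> \<and> \<omega> n = y \<and> \<omega> (Suc n) = z} =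
    measure (simple_random_walk G u) {\<omega>. Q \<omega> \<and> \<omega> n = y} * pmf (pmf_of_set {w. (y, w) \<in> parcs G}) z"
proof -
  let ?M = "simple_random_walk G u"
  interpret prob_space ?M by (rule prob_space_simple_random_walk)
  \<comment> \<open>The histories compatible with the event, made unique by extensionality outside \<open>{..n}\<close>.\<close>
  define S where "S = {x \<in> {..n} \<rightarrow>\<^sub>E UNIV. Q x \<and> x n = y}"
  define cyl where "cyl x = {\<omega>. \<forall>i<Suc n. \<omega> i = x i}" for x :: "nat \<Rightarrow> 'v"
  define cyl' where "cyl' x = {\<omega>. \<forall>i<Suc (Suc n). \<omega> i = (x(Suc n := z)) i}" for x :: "nat \<Rightarrow> 'v"
  have fin: "finite S"
    unfolding S_def by (rule finite_subset[OF _ finite_PiE[of "{..n}" "\<lambda>_. UNIV"]]) auto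
  have meas: "cyl x \<in> sets ?M" "cyl' x \<in> sets ?M" for x
  proof -
    have "{\<omega> \<in> space ?M. \<forall>i<m. \<omega> i = x' i} \<in> sets ?M" for m x'
      by measurable
    then show "cyl x \<in> sets ?M" "cyl' x \<in> sets ?M"
      by (simp_all add: cyl_def cyl'_def)
  qed
  have rep: "\<exists>x\<in>S. \<forall>i<Suc n. \<omega> i = x i" if "Q \<omega>" "\<omega> n = y" for \<omega>
  proof (intro bexI allI impI)
    show "restrict \<omega> {..n} \<in> S"
      using that Q[of \<omega> "restrict \<omega> {..n}"] by (auto simp: S_def)
  qed auto
  have Q_cyl: "Q \<omega> \<and> \<omega> n = y" if "x \<in> S" "\<forall>i<Suc n. \<omega> i = x i" for x \<omega>
    using that Q[of x \<omega>] by (auto simp: S_def less_Suc_eq_le)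
  have inj: "x = x'" if "x \<in> S" "x' \<in> S" "\<forall>i<Suc n. x i = x' i" for x x'
    using that by (auto simp: S_def less_Suc_eq_le intro: PiE_ext)
  have U: "{\<omega>. Q \<omega> \<and> \<omega> n = y} = (\<Union>x\<in>S. cyl x)"
    unfolding cyl_def using rep Q_cyl by blast
  have cyl'_eq: "cyl' x = cyl x \<inter> {\<omega>. \<omega> (Suc n) = z}" for x
    by (auto simp: cyl'_def cyl_def less_Suc_eq)
  have "{\<omega>. Q \<omega> \<and> \<omega> n = y \<and> \<omega> (Suc n) = z} = {\<omega>. Q \<omega> \<and> \<omega> n = y} \<inter> {\<omega>. \<omega> (Suc n) = z}"
    by blast
  also have "\<dots> = (\<Union>x\<in>S. cyl' x)"
    unfolding U cyl'_eq by blast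
  finally have U': "{\<omega>. Q \<omega> \<and> \<omega> n = y \<and> \<omega> (Suc n) = z} = (\<Union>x\<in>S. cyl' x)" .
  have disj: "disjoint_family_on cyl S"
    unfolding disjoint_family_on_def
  proof (intro ballI impI)
    fix x x' assume "x \<in> S" "x' \<in> S" "x \<noteq> x'"
    then obtain i where i: "i < Suc n" "x i \<noteq> x' i"
      using inj[of x x'] by blast
    have False if "\<omega> \<in> cyl x" "\<omega> \<in> cyl x'" for \<omega>
    proof -
      have "\<omega> i = x i" "\<omega> i = x' i"
        using that i(1) unfolding cyl_def by blast+
      with i(2) show False by simp
    qed
    then show "cyl x \<inter> cyl x' = {}" by blast
  qed
  have disj': "disjoint_family_on cyl' S"
    using disj unfolding disjoint_family_on_def cyl'_eq by blast
  have step: "measure ?M (cyl' x) = measure ?M (cyl x) * pmf (pmf_of_set {w. (y, w) \<in> parcs G}) z"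
    if "x \<in> S" for x
  proof -
    have "(\<Prod>i<Suc n. pmf (walk_step G u i (x(Suc n := z))) ((x(Suc n := z)) i)) =
        (\<Prod>i<Suc n. pmf (walk_step G u i x) (x i))"
      by (intro prod.cong) (auto simp: walk_step_def split: nat.split)
    moreover have "walk_step G u (Suc n) (x(Suc n := z)) = pmf_of_set {w. (y, w) \<in> parcs G}"
      using that by (simp add: walk_step_def S_def)
    ultimately show ?thesis
      unfolding cyl_def cyl'_def measure_simple_random_walk_cylinder
      by (subst prod.lessThan_Suc) simp
  qed
  have "measure ?M {\<omega>. Q \<omega> \<and> \<omega> n = y \<and> \<omega> (Suc n) = z} = (\<Sum>x\<in>S. measure ?M (cyl' x))"
    unfolding U' using fin meas disj' by (intro finite_measure_finite_Union) auto
  also have "\<dots> = (\<Sum>x\<in>S. measure ?M (cyl x)) * pmf (pmf_of_set {w. (y, w) \<in> parcs G}) z"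
    by (simp add: step sum_distrib_right)
  also have "(\<Sum>x\<in>S. measure ?M (cyl x)) = measure ?M {\<omega>. Q \<omega> \<and> \<omega> n = y}"
    unfolding U using fin meas disj by (intro finite_measure_finite_Union[symmetric]) auto
  finally show ?thesis .
qed

section \<open>The tail of the hitting time\<close>

definition neighbour_average :: "'v pair_pre_digraph \<Rightarrow> ('v \<Rightarrow> real) \<Rightarrow> 'v \<Rightarrow> real" where
  "neighbour_average G f x = (\<Sum>y | (x, y) \<in> parcs G. f y) / card {y. (x, y) \<in> parcs G}"

text \<open>
  The probability that the walk started at \<open>x\<close> avoids \<open>v\<close> at times \<open>0, \<dots>, n\<close>, in the form given by
  conditioning on the first step; \<open>measure_not_hit_eq_survival\<close> justifies the reading.
\<close>

fun survival :: "'v pair_pre_digraph \<Rightarrow> 'v \<Rightarrow> nat \<Rightarrow> 'v \<Rightarrow> real" where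
  "survival G v 0 x = (if x = v then 0 else 1)"
| "survival G v (Suc n) x = (if x = v then 0 else neighbour_average G (survival G v n) x)"

lemma survival_target [simp]: "survival G v n v = 0"
  by (cases n) simp_all

lemma survival_nonneg: "0 \<le> survival G v n x"
  by (induction n arbitrary: x) (auto simp: neighbour_average_def intro!: divide_nonneg_nonneg sum_nonneg)

lemma neighbour_average_eq_pmf:
  fixes G :: "'v::finite pair_pre_digraph"
  assumes "{y. (x, y) \<in> parcs G} \<noteq> {}"
  shows "neighbour_average G f x = (\<Sum>z\<in>UNIV. pmf (pmf_of_set {y. (x, y) \<in> parcs G}) z * f z)"
  using assms unfolding neighbour_average_def sum_divide_distrib
  by (intro sum.mono_neutral_cong_left) auto

text \<open>
  The walk's law is accessible through its last step, whereas \<open>survival\<close> recurses on the first. The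
  two meet by duality: with \<open>a n z\<close> the probability of being at \<open>z\<close> at time \<open>n\<close> without an earlier
  visit to \<open>v\<close>, the pairing of \<open>a n\<close> with \<open>survival G v m\<close> depends only on \<open>n + m\<close>.
\<close>

lemma measure_not_hit_eq_survival:
  fixes G :: "'v::finite pair_pre_digraph"
  assumes nbr: "\<And>x. {y. (x, y) \<in> parcs G} \<noteq> {}"
  shows "measure (simple_random_walk G u) {\<omega>. \<forall>i\<le>n. \<omega> i \<noteq> v} = survival G v n u"
proof -
  let ?M = "simple_random_walk G u"
  interpret prob_space ?M by (rule prob_space_simple_random_walk)
  define a where "a n z = measure ?M {\<omega>. (\<forall>i<n. \<omega> i \<noteq> v) \<and> \<omega> n = z}" for n z
  have a_0: "a 0 z = (if z = u then 1 else 0)" for z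
    using measure_simple_random_walk_cylinder[of G u 1 "\<lambda>_. z"]
    by (simp add: a_def walk_step_def indicator_def)
  have a_Suc: "a (Suc n) z =
      (\<Sum>y\<in>-{v}. a n y * pmf (pmf_of_set {w. (y, w) \<in> parcs G}) z)" for n z
  proof -
    let ?E = "\<lambda>y. {\<omega>. (\<forall>i<n. \<omega> i \<noteq> v) \<and> \<omega> n = y \<and> \<omega> (Suc n) = z}"
    have meas: "?E y \<in> events" for y
    proof -
      have "{\<omega> \<in> space ?M. (\<forall>i<n. \<omega> i \<noteq> v) \<and> \<omega> n = y \<and> \<omega> (Suc n) = z} \<in> events"
        by measurable
      then show ?thesis by simp
    qed
    have "{\<omega>. (\<forall>i<Suc n. \<omega> i \<noteq> v) \<and> \<omega> (Suc n) = z} = (\<Union>y\<in>-{v}. ?E y)"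
      by (auto simp: less_Suc_eq)
    then have "a (Suc n) z = measure ?M (\<Union>y\<in>-{v}. ?E y)"
      by (simp add: a_def)
    also have "\<dots> = (\<Sum>y\<in>-{v}. measure ?M (?E y))"
      using meas
      by (intro finite_measure_finite_Union) (auto simp: disjoint_family_on_def)
    also have "\<dots> = (\<Sum>y\<in>-{v}. a n y * pmf (pmf_of_set {w. (y, w) \<in> parcs G}) z)"
      unfolding a_def by (intro sum.cong refl measure_simple_random_walk_markov) auto
    finally show ?thesis .
  qed
  have shift: "(\<Sum>z\<in>UNIV. a n z * survival G v m z) = survival G v (n + m) u" for m
  proof (induction n arbitrary: m)
    case 0
    then show ?case by (simp add: a_0 if_distrib[of "\<lambda>b. b * _"] cong: if_cong)
  next
    case (Suc n)
    have "(\<Sum>z\<in>UNIV. a (Suc n) z * survival G v m z) =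
        (\<Sum>z\<in>UNIV. \<Sum>y\<in>-{v}. a n y * (pmf (pmf_of_set {w. (y, w) \<in> parcs G}) z * survival G v m z))"
      by (simp add: a_Suc sum_distrib_right mult.assoc)
    also have "\<dots> = (\<Sum>y\<in>-{v}. a n y * survival G v (Suc m) y)"
      by (subst sum.swap)
        (auto simp: neighbour_average_eq_pmf[OF nbr] sum_distrib_left intro!: sum.cong)
    also have "\<dots> = (\<Sum>y\<in>UNIV. a n y * survival G v (Suc m) y)"
      by (intro sum.mono_neutral_left) auto
    finally show ?case using Suc.IH[of "Suc m"] by simp
  qed
  have meas: "{\<omega>. (\<forall>i<n. \<omega> i \<noteq> v) \<and> \<omega> n = z} \<in> events" for z
  proof -
    have "{\<omega> \<in> space ?M. (\<forall>i<n. \<omega> i \<noteq> v) \<and> \<omega> n = z} \<in> events"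
      by measurable
    then show ?thesis by simp
  qed
  have "{\<omega>. \<forall>i\<le>n. \<omega> i \<noteq> v} = (\<Union>z\<in>-{v}. {\<omega>. (\<forall>i<n. \<omega> i \<noteq> v) \<and> \<omega> n = z})"
    by (auto simp: le_less)
  then have "measure ?M {\<omega>. \<forall>i\<le>n. \<omega> i \<noteq> v} =
      measure ?M (\<Union>z\<in>-{v}. {\<omega>. (\<forall>i<n. \<omega> i \<noteq> v) \<and> \<omega> n = z})"
    by simp
  also have "\<dots> = (\<Sum>z\<in>-{v}. a n z)"
    unfolding a_def using meas by (intro finite_measure_finite_Union) (auto simp: disjoint_family_on_def)
  also have "\<dots> = (\<Sum>z\<in>UNIV. a n z * survival G v 0 z)"
    by (intro sum.mono_neutral_cong_left) auto
  finally show ?thesis using shift[of 0] by simp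
qed

text \<open>The pointwise form of the tail sum formula; both sides are infinite if \<open>v\<close> is never visited.\<close>

lemma first_hit_eq_suminf: "first_hit v \<omega> = (\<Sum>n. indicator {\<omega>. \<forall>i\<le>n. \<omega> i \<noteq> v} \<omega>)"
proof (cases "\<exists>n. \<omega> n = v")
  case True
  define N where "N = (LEAST n. \<omega> n = v)"
  have N: "\<omega> N = v" "\<And>n. \<omega> n = v \<Longrightarrow> N \<le> n"
    using True by (auto simp: N_def intro: LeastI Least_le)
  have "first_hit v \<omega> = of_nat N"
    unfolding first_hit_def using N by (intro antisym INF_lower INF_greatest) auto
  moreover have "(\<Sum>n. indicator {\<omega>. \<forall>i\<le>n. \<omega> i \<noteq> v} \<omega>) = (\<Sum>n<N. indicator {\<omega>. \<forall>i\<le>n. \<omega> i \<noteq> v} \<omega> :: ennreal)"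
  proof (rule suminf_finite)
    fix n assume "n \<notin> {..<N}"
    then have "\<exists>i\<le>n. \<omega> i = v"
      using N(1) by (intro exI[of _ N]) simp
    then show "indicator {\<omega>. \<forall>i\<le>n. \<omega> i \<noteq> v} \<omega> = (0::ennreal)"
      by (simp add: indicator_def)
  qed simp
  moreover have "\<dots> = (\<Sum>n<N. 1)"
  proof (rule sum.cong)
    fix n assume "n \<in> {..<N}"
    then have "\<omega> i \<noteq> v" if "i \<le> n" for i
      using N(2)[of i] that by auto
    then show "indicator {\<omega>. \<forall>i\<le>n. \<omega> i \<noteq> v} \<omega> = (1::ennreal)"
      by (simp add: indicator_def)
  qed simp
  ultimately show ?thesis by simp
next
  case False
  then have "{n. \<omega> n = v} = {}" and "indicator {\<omega>. \<forall>i\<le>n. \<omega> i \<noteq> v} \<omega> = (1::ennreal)" for n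
    by (simp_all add: indicator_def)
  moreover have "(\<Sum>n. 1 :: ennreal) = top"
    by (simp only: suminf_eq_SUP sum_constant card_lessThan mult_1_right ennreal_SUP_of_nat_eq_top)
  ultimately show ?thesis
    by (simp only: first_hit_def image_empty Inf_empty)
qed

theorem avg_hitting_time_eq_suminf_survival:
  fixes G :: "'v::finite pair_pre_digraph"
  assumes "\<And>x. {y. (x, y) \<in> parcs G} \<noteq> {}"
  shows "avg_hitting_time G (v, u) = (\<Sum>n. ennreal (survival G v n u))"
proof -
  let ?M = "simple_random_walk G u"
  interpret prob_space ?M by (rule prob_space_simple_random_walk)
  have [measurable]: "{\<omega>. \<forall>i\<le>n. \<omega> i \<noteq> v} \<in> sets ?M" for n
  proof -
    have "{\<omega> \<in> space ?M. \<forall>i\<le>n. \<omega> i \<noteq> v} \<in> sets ?M" by measurable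
    then show ?thesis by simp
  qed
  have "avg_hitting_time G (v, u) = (\<integral>\<^sup>+\<omega>. (\<Sum>n. indicator {\<omega>. \<forall>i\<le>n. \<omega> i \<noteq> v} \<omega>) \<partial>?M)"
    by (simp add: avg_hitting_time_def first_hit_eq_suminf)
  also have "\<dots> = (\<Sum>n. \<integral>\<^sup>+\<omega>. indicator {\<omega>. \<forall>i\<le>n. \<omega> i \<noteq> v} \<omega> \<partial>?M)"
    by (intro nn_integral_suminf) measurable
  also have "\<dots> = (\<Sum>n. ennreal (survival G v n u))"
    by (simp add: emeasure_eq_measure measure_not_hit_eq_survival[OF assms])
  finally show ?thesis .
qed

section \<open>Regular graphs\<close>

text \<open>The uniform distribution is stationary: on a regular graph each value is counted \<open>k\<close> times with
  weight \<open>1 / k\<close>.\<close>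

lemma sum_neighbour_average:
  fixes G :: "'v::finite pair_pre_digraph"
  assumes "sym (parcs G)" and card: "\<And>x. card {y. (x, y) \<in> parcs G} = k" and "0 < k"
  shows "(\<Sum>x\<in>UNIV. neighbour_average G f x) = (\<Sum>x\<in>UNIV. f x)"
proof -
  have "(\<Sum>x\<in>UNIV. \<Sum>y | (x, y) \<in> parcs G. f y) = (\<Sum>y\<in>UNIV. \<Sum>x | (x, y) \<in> parcs G. f y)"
    using sum.swap_restrict[of UNIV UNIV "\<lambda>x y. f y" "\<lambda>x y. (x, y) \<in> parcs G"] by simp
  also have "\<dots> = (\<Sum>y\<in>UNIV. k * f y)"
  proof (intro sum.cong refl)
    fix y
    have "{x. (x, y) \<in> parcs G} = {x. (y, x) \<in> parcs G}"
      using \<open>sym (parcs G)\<close> by (auto dest: symD)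
    then show "(\<Sum>x | (x, y) \<in> parcs G. f y) = k * f y" by (simp add: card)
  qed
  also have "\<dots> = k * (\<Sum>y\<in>UNIV. f y)"
    by (rule sum_distrib_left[symmetric])
  finally have "(\<Sum>x\<in>UNIV. \<Sum>y | (x, y) \<in> parcs G. f y) / k = (\<Sum>y\<in>UNIV. f y)"
    using \<open>0 < k\<close> by simp
  then show ?thesis
    unfolding neighbour_average_def card sum_divide_distrib .
qed

text \<open>
  The minimum principle: where a nonnegative harmonic function vanishes, it vanishes at all
  neighbours too, and the zeros spread over the connected graph.
\<close>

lemma nonneg_harmonic_zero:
  fixes G :: "'v::finite pair_pre_digraph"
  assumes "sym (parcs G)" and nbr: "\<And>x. {y. (x, y) \<in> parcs G} \<noteq> {}"
    and conn: "Digraph_Component.connected (with_proj G)" and "pverts G = UNIV"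
    and nonneg: "\<And>x. 0 \<le> f x" and harm: "\<And>x. neighbour_average G f x = f x" and "f v = 0"
  shows "f x = 0"
proof -
  have step: "f y = 0" if "f x = 0" "(x, y) \<in> parcs G" for x y
  proof -
    have "(\<Sum>y | (x, y) \<in> parcs G. f y) = 0"
      using harm[of x] that nbr[of x] by (auto simp: neighbour_average_def card_gt_0_iff)
    then show ?thesis
      using that nonneg by (subst (asm) sum_nonneg_eq_0_iff) auto
  qed
  interpret pair_wf_digraph G
    using \<open>pverts G = UNIV\<close> by unfold_locales auto
  have "strongly_connected (with_proj G)"
    using conn \<open>sym (parcs G)\<close>
    by (intro symmetric_connected_imp_strongly_connected) (auto simp: symmetric_def)
  then have "v \<rightarrow>\<^sup>*\<^bsub>with_proj G\<^esub> x"
    using \<open>pverts G = UNIV\<close> by (auto simp: strongly_connected_def)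
  then show ?thesis
    by (induction rule: reachable_induct) (auto simp: \<open>f v = 0\<close> intro: step)
qed

lemma neighbour_average_mono:
  assumes "\<And>x. f x \<le> g x" shows "neighbour_average G f x \<le> neighbour_average G g x"
  using assms by (auto simp: neighbour_average_def intro!: divide_right_mono sum_mono)

lemma decseq_survival:
  fixes G :: "'v::finite pair_pre_digraph" shows "decseq (\<lambda>n. survival G v n x)"
proof (rule decseq_SucI)
  fix n show "survival G v (Suc n) x \<le> survival G v n x"
  proof (induction n arbitrary: x)
    case 0
    have "neighbour_average G (survival G v 0) x \<le> neighbour_average G (\<lambda>_. 1) x"
      by (intro neighbour_average_mono) simp
    also have "\<dots> \<le> 1" by (simp add: neighbour_average_def)
    finally show ?case by simp
  next
    case (Suc n)
    then show ?case by (auto intro!: neighbour_average_mono simp del: survival.simps(2)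
      simp: survival.simps(2)[of G v n] survival.simps(2)[of G v "Suc n"])
  qed
qed

text \<open>
  The probability that the return time to \<open>v\<close> exceeds \<open>n + 1\<close> is the \<open>n\<close>-th summand, so this is Kac's
  formula (the mean return time is the number of vertices), with the first step not counted.
  The sum telescopes by stationarity. The tails decrease to a limit that is harmonic: away
  from \<open>v\<close> by their recursion, and at \<open>v\<close> because the increments of a convergent sequence tend to
  \<open>0\<close>. As it vanishes at \<open>v\<close>, the limit is \<open>0\<close>.
\<close>

theorem sums_neighbour_average_survival:
  fixes G :: "'v::finite pair_pre_digraph"
  assumes sym: "sym (parcs G)" and card: "\<And>x. card {y. (x, y) \<in> parcs G} = k" and "0 < k"
    and conn: "Digraph_Component.connected (with_proj G)" and "pverts G = UNIV"
  shows "(\<lambda>n. neighbour_average G (survival G v n) v) sums (real CARD('v) - 1)"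
proof -
  define S where "S n = (\<Sum>x\<in>UNIV. survival G v n x)" for n
  have nbr: "{y. (x, y) \<in> parcs G} \<noteq> {}" for x
    using card[of x] \<open>0 < k\<close> by (metis card.empty less_irrefl)
  have telescope: "neighbour_average G (survival G v n) v = S n - S (Suc n)" for n
  proof -
    have "S (Suc n) = (\<Sum>x\<in>-{v}. neighbour_average G (survival G v n) x)"
      unfolding S_def by (intro sum.mono_neutral_cong_right) auto
    moreover have "S n = (\<Sum>x\<in>UNIV. neighbour_average G (survival G v n) x)"
      unfolding S_def using assms by (intro sum_neighbour_average[symmetric]) auto
    moreover have "\<dots> = neighbour_average G (survival G v n) v
        + (\<Sum>x\<in>UNIV-{v}. neighbour_average G (survival G v n) x)"
      by (intro sum.remove) auto
    ultimately show ?thesis by (simp add: Compl_eq_Diff_UNIV)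
  qed
  have "\<exists>f. \<forall>x. (\<lambda>n. survival G v n x) \<longlonglongrightarrow> f x"
    using decseq_convergent[OF decseq_survival] survival_nonneg by metis
  then obtain f where f: "(\<lambda>n. survival G v n x) \<longlonglongrightarrow> f x" for x by blast
  have avg_lim: "(\<lambda>n. neighbour_average G (survival G v n) x) \<longlonglongrightarrow> neighbour_average G f x" for x
    unfolding neighbour_average_def using f by (intro tendsto_intros) (auto simp: card \<open>0 < k\<close>[THEN less_imp_neq, symmetric])
  have S_lim: "S \<longlonglongrightarrow> (\<Sum>x\<in>UNIV. f x)"
    unfolding S_def using f by (intro tendsto_intros)
  have "f v = 0" using f[of v] by (simp add: LIMSEQ_const_iff)
  have harm: "neighbour_average G f x = f x" for x
  proof (cases "x = v")
    case True
    have "(\<lambda>n. S n - S (Suc n)) \<longlonglongrightarrow> 0"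
      using tendsto_diff[OF S_lim LIMSEQ_Suc[OF S_lim]] by simp
    with avg_lim[of v] show ?thesis
      using True \<open>f v = 0\<close> by (simp add: telescope LIMSEQ_unique)
  next
    case False
    with avg_lim[of x] LIMSEQ_Suc[OF f[of x]] show ?thesis by (simp add: LIMSEQ_unique)
  qed
  have f_nonneg: "0 \<le> f x" for x
    using LIMSEQ_le_const[OF f[of x], of 0] by (simp add: survival_nonneg)
  have "f x = 0" for x
    using nonneg_harmonic_zero[OF sym nbr conn \<open>pverts G = UNIV\<close> f_nonneg harm \<open>f v = 0\<close>] .
  then have "S \<longlonglongrightarrow> 0" using S_lim by simp
  then have "(\<lambda>n. S n - S (Suc n)) sums (S 0 - 0)" by (rule telescope_sums')
  moreover have "S 0 = real CARD('v) - 1"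
  proof -
    have "S 0 = (\<Sum>x\<in>UNIV - {v}. 1)"
      unfolding S_def by (intro sum.mono_neutral_cong_right) auto
    then show ?thesis
      by (simp add: card_Diff_singleton of_nat_diff Suc_leI)
  qed
  ultimately show ?thesis by (simp add: telescope)
qed

section \<open>Association schemes\<close>

context symmetric_association_scheme
begin

lemma entry_sum: "(\<Sum>j\<le>d. A j $ x $ y) = 1"
  using arg_cong[OF sum_A, of "\<lambda>M. M $ x $ y"] by simp

lemma entry_unique:
  assumes "i \<le> d" "A i $ x $ y = 1" "j \<le> d"
  shows "A j $ x $ y = (if j = i then 1 else 0)"
proof (cases "j = i")
  case False
  have nonneg: "0 \<le> A l $ x $ y" if "l \<le> d" for l
    using zero_one[OF that, of x y] by auto
  have "(\<Sum>l\<in>{..d}-{i}. A l $ x $ y) = 0"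
    using entry_sum[of x y] assms by (simp add: sum.remove[of "{..d}" i])
  then have "A j $ x $ y = 0"
    using assms False nonneg by (subst (asm) sum_nonneg_eq_0_iff) auto
  then show ?thesis using False by simp
qed (use assms in simp)

lemma combination_entry:
  assumes "i \<le> d" "A i $ x $ y = 1"
  shows "(\<Sum>j\<le>d. c j * A j $ x $ y) = c i"
proof -
  have "(\<Sum>j\<le>d. c j * A j $ x $ y) = (\<Sum>j\<le>d. if j = i then c j else 0)"
    by (intro sum.cong refl) (simp add: entry_unique[OF assms])
  then show ?thesis
    using assms by simp
qed

lemma diagonal_entry: "j \<le> d \<Longrightarrow> A j $ x $ x = (if j = 0 then 1 else 0)"
  using entry_unique[of 0 x x j] by (simp add: A_0 mat_def)

lemma entry_sym: "i \<le> d \<Longrightarrow> A i $ x $ y = A i $ y $ x"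
  using arg_cong[OF symmetric_A[of i], of "\<lambda>M. M $ x $ y"] by (simp add: transpose_def)

text \<open>The matrix \<open>A i\<close> is 0/1 and symmetric, so its row sums are the diagonal entries of its square,
  and these all equal the coefficient of \<open>A 0\<close> in the square.\<close>

lemma valency: assumes "i \<le> d" shows "\<exists>k::nat. \<forall>x. (\<Sum>y\<in>UNIV. A i $ x $ y) = real k"
proof -
  obtain p :: "nat \<Rightarrow> nat" where p: "A i ** A i = (\<Sum>k\<le>d. real (p k) *\<^sub>R A k)"
    using mult_A assms by blast
  have "(\<Sum>y\<in>UNIV. A i $ x $ y) = real (p 0)" for x
  proof -
    have "(\<Sum>y\<in>UNIV. A i $ x $ y) = (\<Sum>y\<in>UNIV. A i $ x $ y * A i $ y $ x)"
      using zero_one[OF assms, of x] entry_sym[OF assms, of _ x]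
      by (intro sum.cong refl) (metis insert_iff mult_1 mult_zero_left singletonD)
    also have "\<dots> = (A i ** A i) $ x $ x" by (simp add: matrix_matrix_mult_def)
    also have "\<dots> = (\<Sum>k\<le>d. real (p k) * A k $ x $ x)" by (simp add: p)
    also have "\<dots> = real (p 0)"
      using combination_entry[of 0 x x "\<lambda>k. real (p k)"] by (simp add: A_0 mat_def)
    finally show ?thesis .
  qed
  then show ?thesis by blast
qed

lemma product_combination:
  assumes "i \<le> d"
  shows "\<exists>c'. \<forall>x z. (\<Sum>y\<in>UNIV. A i $ x $ y * (\<Sum>j\<le>d. c j * A j $ y $ z)) = (\<Sum>j\<le>d. c' j * A j $ x $ z)"
proof -
  have "\<forall>j\<in>{..d}. \<exists>p :: nat \<Rightarrow> nat. A i ** A j = (\<Sum>k\<le>d. real (p k) *\<^sub>R A k)"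
    using mult_A assms by simp
  then obtain p :: "nat \<Rightarrow> nat \<Rightarrow> nat" where p: "\<And>j. j \<le> d \<Longrightarrow> A i ** A j = (\<Sum>k\<le>d. real (p j k) *\<^sub>R A k)"
    unfolding bchoice_iff by auto
  have "(\<Sum>y\<in>UNIV. A i $ x $ y * (\<Sum>j\<le>d. c j * A j $ y $ z)) =
      (\<Sum>k\<le>d. (\<Sum>j\<le>d. c j * p j k) * A k $ x $ z)" for x z
  proof -
    have "(\<Sum>y\<in>UNIV. A i $ x $ y * (\<Sum>j\<le>d. c j * A j $ y $ z)) =
        (\<Sum>j\<le>d. c j * (A i ** A j) $ x $ z)"
      unfolding matrix_matrix_mult_def sum_distrib_left
      by (subst sum.swap) (simp add: sum_distrib_left mult_ac)
    also have "\<dots> = (\<Sum>j\<le>d. \<Sum>k\<le>d. c j * p j k * A k $ x $ z)"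
      by (intro sum.cong refl) (simp add: p sum_distrib_left mult_ac)
    also have "\<dots> = (\<Sum>k\<le>d. (\<Sum>j\<le>d. c j * p j k) * A k $ x $ z)"
      by (subst sum.swap) (simp add: sum_distrib_right)
    finally show ?thesis .
  qed
  then show ?thesis
    by (intro exI[of _ "\<lambda>k. \<Sum>j\<le>d. c j * real (p j k)"] allI)
qed

text \<open>
  Expressing \<open>survival\<close> by one coefficient per class, uniformly in both vertices, is what makes the
  induction work: the averaging step is a product with \<open>A i\<close>, which mixes all starting vertices.
  Resetting to \<open>0\<close> at the target amounts to dropping the coefficient of \<open>A 0\<close>.
\<close>

lemma survival_combination:
  assumes "i \<le> d" and G: "\<And>x y. A i $ x $ y = (if (x, y) \<in> parcs G then 1 else 0)"
    and card: "\<And>x. card {y. (x, y) \<in> parcs G} = k"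
  shows "\<exists>c. \<forall>x v. survival G v n x = (\<Sum>j\<le>d. c j * A j $ x $ v)"
proof -
  have mask: "\<exists>c'. \<forall>x v. (if x = v then 0 else \<Sum>j\<le>d. c j * A j $ x $ v) = (\<Sum>j\<le>d. c' j * A j $ x $ v)" for c :: "nat \<Rightarrow> real"
  proof (intro exI allI)
    fix x v
    show "(if x = v then 0 else \<Sum>j\<le>d. c j * A j $ x $ v) = (\<Sum>j\<le>d. (c(0 := 0)) j * A j $ x $ v)"
    proof (cases "x = v")
      case True
      have "(c(0 := 0)) j * A j $ v $ v = 0" if "j \<le> d" for j
        using that by (simp add: diagonal_entry)
      then have "(\<Sum>j\<le>d. (c(0 := 0)) j * A j $ v $ v) = 0"
        by (intro sum.neutral) blast
      then show ?thesis using True by simp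
    next
      case False
      then have "c j * A j $ x $ v = (c(0 := 0)) j * A j $ x $ v" for j
        by (simp add: A_0 mat_def)
      then show ?thesis using False by (simp only: if_False)
    qed
  qed
  show ?thesis
  proof (induction n)
    case 0
    have "survival G v 0 x = (if x = v then 0 else \<Sum>j\<le>d. 1 * A j $ x $ v)" for x v
      by (simp add: entry_sum)
    then show ?case using mask[of "\<lambda>_. 1"] by simp
  next
    case (Suc n)
    then obtain c where c: "\<And>x v. survival G v n x = (\<Sum>j\<le>d. c j * A j $ x $ v)" by blast
    obtain c' where c': "\<And>x z. (\<Sum>y\<in>UNIV. A i $ x $ y * (\<Sum>j\<le>d. c j * A j $ y $ z)) = (\<Sum>j\<le>d. c' j * A j $ x $ z)"
      using product_combination[OF \<open>i \<le> d\<close>] by blast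
    have "neighbour_average G (survival G v n) x = (\<Sum>j\<le>d. (c' j / k) * A j $ x $ v)" for x v
    proof -
      have "(\<Sum>y | (x, y) \<in> parcs G. survival G v n y) = (\<Sum>y\<in>UNIV. A i $ x $ y * survival G v n y)"
        by (intro sum.mono_neutral_cong_left) (auto simp: G)
      then show ?thesis
        by (simp add: neighbour_average_def card c c' sum_divide_distrib)
    qed
    then have Suc_n: "survival G v (Suc n) x = (if x = v then 0 else \<Sum>j\<le>d. (c' j / k) * A j $ x $ v)" for x v
      unfolding survival.simps by (rule if_cong[OF refl refl])
    show ?case unfolding Suc_n by (rule mask)
  qed
qed

end

theorem corollary4p3:
  fixes A :: "nat \<Rightarrow> real ^ 'v ^ 'v::finite" and d i :: nat
    and G :: "'v pair_pre_digraph" and u v :: 'v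
  assumes "symmetric_association_scheme A d"
    and "1 \<le> i" and "i \<le> d"
    and "pair_graph G" and "pverts G = UNIV"
    and "adjacency_matrix G = A i"
    and "Digraph_Component.connected (with_proj G)"
    and "(u, v) \<in> parcs G"
  shows "avg_hitting_time G (v, u) = of_nat (CARD('v) - 1)"
proof -
  interpret symmetric_association_scheme A d by fact
  interpret G: pair_graph G by fact
  have entry: "A i $ x $ y = (if (x, y) \<in> parcs G then 1 else 0)" for x y
    using arg_cong[OF \<open>adjacency_matrix G = A i\<close>, of "\<lambda>M. M $ x $ y"]
    by (simp add: adjacency_matrix_def)
  have sym: "sym (parcs G)"
    by (auto intro: symI G.arcs_symmetric)
  obtain k :: nat where "\<And>x. (\<Sum>y\<in>UNIV. A i $ x $ y) = real k"
    using valency[OF \<open>i \<le> d\<close>] by blast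
  then have card: "card {y. (x, y) \<in> parcs G} = k" for x
    by (simp add: entry sum.If_cases)
  have "0 < k"
    using card[of u] \<open>(u, v) \<in> parcs G\<close> by (auto simp: card_gt_0_iff)
  then have nbr: "{y. (x, y) \<in> parcs G} \<noteq> {}" for x
    using card[of x] by (metis card.empty less_irrefl)
  have avg: "neighbour_average G (survival G v n) v = survival G v n u" for n
  proof -
    obtain c where c: "\<And>x v. survival G v n x = (\<Sum>j\<le>d. c j * A j $ x $ v)"
      using survival_combination[OF \<open>i \<le> d\<close> entry card] by blast
    have "survival G v n y = c i" if "(y, v) \<in> parcs G" for y
      using that combination_entry[OF \<open>i \<le> d\<close>, of y v c] by (simp add: c entry)
    then show ?thesis
      using \<open>(u, v) \<in> parcs G\<close> \<open>0 < k\<close> sym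
      by (simp add: neighbour_average_def card symD[OF sym] )
  qed
  have "(\<lambda>n. survival G v n u) sums (real CARD('v) - 1)"
    using sums_neighbour_average_survival[OF sym card \<open>0 < k\<close> \<open>connected (with_proj G)\<close> \<open>pverts G = UNIV\<close>, of v]
    by (simp add: avg)
  then have "(\<Sum>n. ennreal (survival G v n u)) = ennreal (real CARD('v) - 1)"
    by (intro suminf_ennreal_eq survival_nonneg)
  then show ?thesis
    by (simp add: avg_hitting_time_eq_suminf_survival[OF nbr] ennreal_of_nat_eq_real_of_nat of_nat_diff Suc_leI)
qed

end
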